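(* The second order discrete initial value problem $$\triangle^{2} f(n) = n \quad (n\in\mathbb{N}), \qquad f(1) = 1, \quad \triangle f(1) = 2,$$ for an unknown real-valued sequence $f:\mathbb{N}\to\mathbb{R}$, has solution given by $$f(n) = 2n-1+\frac{n(n-1)(n-2)}{6} \quad (n\in\mathbb{N}).$$
   Context: Here $\mathbb{N}=\{1,2,3,\dots\}$. For a real-valued sequence $f$, the first order difference is defined by $\triangle f(n) := f(n+1)-f(n)$, and the second order difference by $\triangle^{2} f(n) := \triangle(\triangle f(n)) = f(n+2)-2f(n+1)+f(n)$. *)

theory Defs
  imports Complex_Main
begin

definition forward_difference :: "(nat \<Rightarrow> real) \<Rightarrow> nat \<Rightarrow> real" where
  "forward_difference f n = f (n + 1) - f n"

definition second_difference :: "(nat \<Rightarrow> real) \<Rightarrow> nat \<Rightarrow> real" where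
  "second_difference f = forward_difference (forward_difference f)"

(* Sequences on the positive integers are functions on nat whose value at 0 is irrelevant. *)
definition solves_ivp :: "(nat \<Rightarrow> real) \<Rightarrow> bool" where
  "solves_ivp f \<longleftrightarrow>
     (\<forall>n\<ge>1. second_difference f n = real n) \<and> f 1 = 1 \<and> forward_difference f 1 = 2"

end

theory Submission
  imports Defs
begin

text \<open>
  The equation is solved by summing twice. By Pascal's rule the binomial coefficient \<open>C(n,k)\<close> is
  the forward difference of \<open>C(n,k+1)\<close>, and the right-hand side of the equation is \<open>n = C(n,1)\<close>.
  Hence \<open>C(n,2) + 2\<close> is the first difference of a solution and \<open>C(n,3) + 2 n - 1\<close> the solution
  itself, where the constants \<open>2\<close> and \<open>- 1\<close> are fixed by the two initial values. Since the values of
  \<open>f\<close> and of its difference at \<open>n + 1\<close> are determined by those at \<open>n\<close> and the equation, no other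
  sequence on the positive integers is a solution.
\<close>

text \<open>
  Carrying the sequence and its first difference together turns the second-order recurrence into a
  first-order one, so that plain induction applies.
\<close>

lemma solution_and_its_difference:
  assumes "solves_ivp f" and "n \<ge> 1"
  shows "f n = 2 * real n - 1 + real n * (real n - 1) * (real n - 2) / 6 \<and>
         forward_difference f n = 2 + real n * (real n - 1) / 2"
  using \<open>n \<ge> 1\<close>
proof (induction n rule: dec_induct)
  case base
  show ?case
    using \<open>solves_ivp f\<close> by (simp add: solves_ivp_def)
next
  case (step n)
  have "f (Suc n) = f n + forward_difference f n"
    by (simp add: forward_difference_def)
  moreover have "forward_difference f (Suc n) = forward_difference f n + real n"
    using \<open>solves_ivp f\<close> \<open>1 \<le> n\<close>
    by (auto simp: solves_ivp_def second_difference_def forward_difference_def [of "forward_difference f"]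
        dest: spec [of _ n])
  ultimately show ?case
    using step.IH by (simp add: field_simps)
qed

theorem proposition2:
  fixes f :: "nat \<Rightarrow> real"
  shows "solves_ivp f \<longleftrightarrow>
    (\<forall>n\<ge>1. f n = 2 * real n - 1 + real n * (real n - 1) * (real n - 2) / 6)"
proof
  assume "solves_ivp f"
  then show "\<forall>n\<ge>1. f n = 2 * real n - 1 + real n * (real n - 1) * (real n - 2) / 6"
    using solution_and_its_difference by blast
next
  assume formula: "\<forall>n\<ge>1. f n = 2 * real n - 1 + real n * (real n - 1) * (real n - 2) / 6"
  have difference: "forward_difference f n = 2 + real n * (real n - 1) / 2" if "n \<ge> 1" for n
    using formula [rule_format, of n] formula [rule_format, of "Suc n"] that
    by (simp add: forward_difference_def field_simps)
  have "second_difference f n = real n" if "n \<ge> 1" for n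
    using that
    by (simp add: second_difference_def forward_difference_def [of "forward_difference f"]
        difference field_simps)
  then show "solves_ivp f"
    using formula difference by (simp add: solves_ivp_def)
qed

end
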